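(* For the root lattices $E_6$, $E_7$, $E_8$ and $A_n$ with $n>3$, the set of all screeners is exactly the set of roots. The set of screeners of the root lattice $A_3$ consists of the roots together with exactly $6$ screeners that are not roots; these satisfy $\langle\alpha,\alpha\rangle=4$ and are $$\{\pm(\alpha_1+\alpha_3),\ \pm(\alpha_1-\alpha_3),\ \pm(\alpha_1+2\alpha_2+\alpha_3)\}.$$ Furthermore, the roots of $A_3$ together with these nonroot screeners form the set of roots of a root system of type $C_3$.
   Context: For a positive definite integral lattice $L$ with form $\langle\cdot,\cdot\rangle$, put $L^{(0)}=\{\alpha\in L:\langle\alpha,\alpha\rangle\in2\mathbb Z\}$ and $L^\circ=\{\beta\in\mathbb Q\otimes L:\langle\alpha,\beta\rangle\in\mathbb Z\ \forall\alpha\in L\}$. The set of screeners of $L$ is $\Phi=\{\beta\in L^{(0)}: \beta\notin 2L,\ 2\beta/\langle\beta,\beta\rangle\in L^\circ\}$. Root lattices are normalized so that the roots are the vectors with $\langle\alpha,\alpha\rangle=2$. For $A_n$, $\alpha_1,\dots,\alpha_n$ is a basis of simple roots with $\langle\alpha_i,\alpha_i\rangle=2$, $\langle\alpha_i,\alpha_j\rangle=-1$ if $|i-j|=1$, and $\langle\alpha_i,\alpha_j\rangle=0$ if $|i-j|>1$. *)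

theory Defs
  imports "HOL-Analysis.Analysis"
begin

text \<open>
  A positive definite integral lattice \<open>L\<close> is realised inside a real inner product space, as the
  integral span of a linearly independent set. The form is then the inner product, and
  \<open>\<rat> \<otimes> L\<close> is the rational span of \<open>L\<close>.
\<close>

lemma module_scaleR_of_int: "module (\<lambda>(k::int) (x::'a::real_vector). of_int k *\<^sub>R x)"
  by unfold_locales (simp_all add: algebra_simps)

lemma module_scaleR_of_rat: "module (\<lambda>(q::rat) (x::'a::real_vector). of_rat q *\<^sub>R x)"
  by unfold_locales (simp_all add: algebra_simps of_rat_add of_rat_mult)

definition int_span :: "'a::real_vector set \<Rightarrow> 'a set" where
  "int_span = module.span (\<lambda>(k::int) x. of_int k *\<^sub>R x)"

definition rat_span :: "'a::real_vector set \<Rightarrow> 'a set" where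
  "rat_span = module.span (\<lambda>(q::rat) x. of_rat q *\<^sub>R x)"

definition even_part :: "'a::real_inner set \<Rightarrow> 'a set" where
  "even_part L = {\<alpha> \<in> L. \<exists>k::int. \<alpha> \<bullet> \<alpha> = 2 * of_int k}"

definition dual_lattice :: "'a::real_inner set \<Rightarrow> 'a set" where
  "dual_lattice L = {\<beta> \<in> rat_span L. \<forall>\<alpha>\<in>L. \<alpha> \<bullet> \<beta> \<in> \<int>}"

text \<open>The zero vector lies in \<open>2L\<close>, so the division by \<open>\<beta> \<bullet> \<beta>\<close> is harmless.\<close>

definition screeners :: "'a::real_inner set \<Rightarrow> 'a set" where
  "screeners L = {\<beta> \<in> even_part L. \<beta> \<notin> (*\<^sub>R) 2 ` L \<and> (2 / (\<beta> \<bullet> \<beta>)) *\<^sub>R \<beta> \<in> dual_lattice L}"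

definition lattice_roots :: "'a::real_inner set \<Rightarrow> 'a set" where
  "lattice_roots L = {\<alpha> \<in> L. \<alpha> \<bullet> \<alpha> = 2}"

text \<open>
  Cartan matrices, with rows and columns numbered from 1 as in Bourbaki. For the simply laced types
  the entries do not depend on the rank. In type \<open>E\<close> the diagram is the chain
  \<open>1 - 3 - 4 - 5 - \<dots>\<close> with node 2 attached to node 4. The entry in row \<open>i\<close> and column \<open>j\<close> is
  \<open>2 \<langle>\<alpha>\<^sub>i, \<alpha>\<^sub>j\<rangle> / \<langle>\<alpha>\<^sub>j, \<alpha>\<^sub>j\<rangle>\<close>, so that the last simple root in type \<open>C\<close> is the long one.
\<close>

definition cartan_A :: "nat \<Rightarrow> nat \<Rightarrow> int" where
  "cartan_A i j = (if i = j then 2 else if j = i + 1 \<or> i = j + 1 then -1 else 0)"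

definition cartan_E :: "nat \<Rightarrow> nat \<Rightarrow> int" where
  "cartan_E i j =
    (if i = j then 2
     else if {i, j} \<in> {{1, 3}, {2, 4}} \<union> {{k, k + 1} | k. 3 \<le> k} then -1
     else 0)"

definition cartan_C :: "nat \<Rightarrow> nat \<Rightarrow> nat \<Rightarrow> int" where
  "cartan_C n i j = (if i = n \<and> j + 1 = n then -2 else cartan_A i j)"

text \<open>
  \<open>L\<close> is the root lattice with simple roots \<open>\<alpha> 1, \<dots>, \<alpha> n\<close> of the simply laced type with Cartan
  matrix \<open>A\<close>. As roots have norm 2, the Cartan matrix is the Gram matrix of the simple roots.
\<close>

definition root_lattice :: "(nat \<Rightarrow> nat \<Rightarrow> int) \<Rightarrow> nat \<Rightarrow> (nat \<Rightarrow> 'a::real_inner) \<Rightarrow> 'a set \<Rightarrow> bool" where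
  "root_lattice A n \<alpha> L \<longleftrightarrow>
     inj_on \<alpha> {1..n} \<and> independent (\<alpha> ` {1..n}) \<and>
     (\<forall>i\<in>{1..n}. \<forall>j\<in>{1..n}. \<alpha> i \<bullet> \<alpha> j = of_int (A i j)) \<and>
     L = int_span (\<alpha> ` {1..n})"

text \<open>Reduced crystallographic root systems in the Euclidean space \<open>V\<close>.\<close>

definition root_system :: "'a::real_inner set \<Rightarrow> 'a set \<Rightarrow> bool" where
  "root_system V \<Phi> \<longleftrightarrow>
     finite \<Phi> \<and> 0 \<notin> \<Phi> \<and> span \<Phi> = V \<and>
     (\<forall>\<alpha>\<in>\<Phi>. \<forall>c. c *\<^sub>R \<alpha> \<in> \<Phi> \<longrightarrow> c = 1 \<or> c = -1) \<and>
     (\<forall>\<alpha>\<in>\<Phi>. \<forall>\<beta>\<in>\<Phi>. \<beta> - (2 * (\<beta> \<bullet> \<alpha>) / (\<alpha> \<bullet> \<alpha>)) *\<^sub>R \<alpha> \<in> \<Phi>) \<and>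
     (\<forall>\<alpha>\<in>\<Phi>. \<forall>\<beta>\<in>\<Phi>. 2 * (\<beta> \<bullet> \<alpha>) / (\<alpha> \<bullet> \<alpha>) \<in> \<int>)"

definition root_system_base :: "'a::real_inner set \<Rightarrow> 'a set \<Rightarrow> nat \<Rightarrow> (nat \<Rightarrow> 'a) \<Rightarrow> bool" where
  "root_system_base V \<Phi> n \<delta> \<longleftrightarrow>
     \<delta> ` {1..n} \<subseteq> \<Phi> \<and>
     inj_on \<delta> {1..n} \<and> independent (\<delta> ` {1..n}) \<and> span (\<delta> ` {1..n}) = V \<and>
     (\<forall>\<beta>\<in>\<Phi>. \<exists>c :: nat \<Rightarrow> nat.
        \<beta> = (\<Sum>i=1..n. of_nat (c i) *\<^sub>R \<delta> i) \<or> \<beta> = - (\<Sum>i=1..n. of_nat (c i) *\<^sub>R \<delta> i))"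

definition root_system_of_type ::
  "(nat \<Rightarrow> nat \<Rightarrow> int) \<Rightarrow> nat \<Rightarrow> 'a::real_inner set \<Rightarrow> 'a set \<Rightarrow> bool" where
  "root_system_of_type A n V \<Phi> \<longleftrightarrow>
     root_system V \<Phi> \<and>
     (\<exists>\<delta>. root_system_base V \<Phi> n \<delta> \<and>
          (\<forall>i\<in>{1..n}. \<forall>j\<in>{1..n}. 2 * (\<delta> i \<bullet> \<delta> j) / (\<delta> j \<bullet> \<delta> j) = of_int (A i j)))"

definition A3_extra_screeners :: "(nat \<Rightarrow> 'a::real_inner) \<Rightarrow> 'a set" where
  "A3_extra_screeners \<alpha> =
     {\<alpha> 1 + \<alpha> 3, - (\<alpha> 1 + \<alpha> 3),
      \<alpha> 1 - \<alpha> 3, - (\<alpha> 1 - \<alpha> 3),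
      \<alpha> 1 + 2 *\<^sub>R \<alpha> 2 + \<alpha> 3, - (\<alpha> 1 + 2 *\<^sub>R \<alpha> 2 + \<alpha> 3)}"

end

theory Submission imports Defs begin

text \<open>
  Let \<open>\<beta>\<close> be a screener with \<open>\<beta> \<bullet> \<beta> = 2 M\<close> and coordinate vector \<open>b\<close> with respect to the simple
  roots. Being a screener forces \<open>M\<close> to divide every entry of \<open>A b\<close>, where \<open>A\<close> is the Gram matrix, so
  \<open>b = M A\<^sup>-\<^sup>1 d\<close> with \<open>d\<close> integral.
  In type \<open>E\<close>, the values of the form on the dual lattice modulo its values on the lattice leave only
  \<open>M = 1\<close>. In type \<open>A\<close>, put \<open>x i = b i - b (i - 1)\<close>: these \<open>n + 1\<close> integers have sum \<open>0\<close>, are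
  congruent modulo \<open>M\<close>, and have square sum \<open>2 M\<close>; if \<open>M > 1\<close> none of them vanishes, and two of them of
  opposite sign differ by at least \<open>M\<close>, whence \<open>(M - 2)\<^sup>2 + 2 (n - 3) \<le> 0\<close>.
  Finally, the screeners of any lattice are stable under their own reflections, have integral
  Cartan numbers and contain no proper multiples, so only the base of type \<open>C\<^sub>3\<close> has to be exhibited.
\<close>

section \<open>Spans and screeners of a general lattice\<close>

lemma int_span_finite_image:
  assumes "finite I" "inj_on f I"
  shows "int_span (f ` I) = {\<Sum>i\<in>I. of_int (b i) *\<^sub>R f i | b. True}"
proof -
  have "int_span (f ` I) = range (\<lambda>u. \<Sum>v\<in>f ` I. of_int (u v) *\<^sub>R v)"
    unfolding int_span_def using assms by (intro module.span_finite module_scaleR_of_int) auto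
  also have "\<dots> = range (\<lambda>u. \<Sum>i\<in>I. of_int (u (f i)) *\<^sub>R f i)"
    using assms by (simp add: sum.reindex)
  also have "\<dots> = {\<Sum>i\<in>I. of_int (b i) *\<^sub>R f i | b. True}"
  proof (intro equalityI subsetI)
    fix x assume "x \<in> {\<Sum>i\<in>I. of_int (b i) *\<^sub>R f i | b. True}"
    then obtain b where "x = (\<Sum>i\<in>I. of_int (b i) *\<^sub>R f i)" by blast
    also have "\<dots> = (\<Sum>i\<in>I. of_int (b (the_inv_into I f (f i))) *\<^sub>R f i)"
      using assms by (intro sum.cong) (auto simp: the_inv_into_f_f)
    finally show "x \<in> range (\<lambda>u. \<Sum>i\<in>I. of_int (u (f i)) *\<^sub>R f i)"
      by (auto simp: image_iff intro!: exI[where x = "\<lambda>y. b (the_inv_into I f y)"])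
  qed auto
  finally show ?thesis .
qed

text \<open>Membership in the rational span comes for free: if
  \<open>\<beta> \<bullet> \<beta> = 2 * k\<close>, the scaling factor is \<open>1 / k\<close>,
  which is rational, also for \<open>k = 0\<close> with division by zero giving 0.\<close>

lemma screeners_iff:
  "\<beta> \<in> screeners L \<longleftrightarrow>
     \<beta> \<in> L \<and> (\<exists>k::int. \<beta> \<bullet> \<beta> = 2 * of_int k) \<and> \<beta> \<notin> (*\<^sub>R) 2 ` L \<and>
     (\<forall>\<alpha>\<in>L. 2 * (\<alpha> \<bullet> \<beta>) / (\<beta> \<bullet> \<beta>) \<in> \<int>)"
proof -
  have "(2 / (\<beta> \<bullet> \<beta>)) *\<^sub>R \<beta> \<in> rat_span L" if "\<beta> \<in> L" "\<beta> \<bullet> \<beta> = 2 * of_int k" for k :: int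
  proof -
    have "(of_rat (1 / of_int k) :: real) *\<^sub>R \<beta> \<in> rat_span L"
      unfolding rat_span_def
      by (intro module.span_scale module.span_base module_scaleR_of_rat that)
    then show ?thesis using that(2) by (simp add: of_rat_divide)
  qed
  then show ?thesis
    by (auto simp: screeners_def even_part_def dual_lattice_def)
qed

text \<open>The Cartan numbers of the pair in both orders are \<open>2 * c\<close> and
  \<open>2 / c\<close>, two integers with product 4, so \<open>c\<close> is 1, 2 or 1/2 up to sign.
  In the last two cases one of the vectors is twice a lattice vector.\<close>

lemma scaleR_eq_screenerD:
  assumes "\<alpha> \<in> screeners L" "c *\<^sub>R \<alpha> \<in> screeners L" "0 \<in> L" "\<And>x. x \<in> L \<Longrightarrow> - x \<in> L"
  shows "c = 1 \<or> c = -1"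
proof -
  have nz: "\<alpha> \<noteq> 0" "c \<noteq> 0"
    using assms(1-3) by (auto simp: screeners_iff image_iff)
  have "2 * ((c *\<^sub>R \<alpha>) \<bullet> \<alpha>) / (\<alpha> \<bullet> \<alpha>) \<in> \<int>"
    "2 * (\<alpha> \<bullet> (c *\<^sub>R \<alpha>)) / ((c *\<^sub>R \<alpha>) \<bullet> (c *\<^sub>R \<alpha>)) \<in> \<int>"
    using assms(1,2) unfolding screeners_iff by blast+
  then obtain p q :: int where p: "2 * c = of_int p" and q: "2 / c = of_int q"
    using nz by (auto simp: elim!: Ints_cases)
  have "real_of_int (p * q) = 4" using nz p q by (simp flip: p q)
  then have pq: "p * q = 4" by linarith
  then have "p dvd 4" by (metis dvd_triv_left)
  then have "\<bar>p\<bar> \<le> 4" using dvd_imp_le_int[of 4 p] by simp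
  then have "p \<in> {-4,-3,-2,-1,0,1,2,3,4}" by auto
  with pq have "p = 1 \<or> p = -1 \<or> p = 2 \<or> p = -2 \<or> p = 4 \<or> p = -4"
    by auto presburger+
  moreover have False if "p = 4"
  proof -
    have "c = 2" using p that by simp
    then show False using assms(1,2) by (auto simp: screeners_iff)
  qed
  moreover have False if "p = -4"
  proof -
    have "c = -2" using p that by simp
    then have "c *\<^sub>R \<alpha> = 2 *\<^sub>R (- \<alpha>)" by simp
    moreover have "- \<alpha> \<in> L" using assms(1,4) by (simp add: screeners_iff)
    ultimately show False using assms(2) unfolding screeners_iff by blast
  qed
  moreover have False if "p = 1"
  proof -
    have "\<alpha> = 2 *\<^sub>R (c *\<^sub>R \<alpha>)" using p that by simp
    then show False using assms(1,2) unfolding screeners_iff by (metis image_eqI)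
  qed
  moreover have False if "p = -1"
  proof -
    have "\<alpha> = 2 *\<^sub>R (- (c *\<^sub>R \<alpha>))" using p that by simp
    then show False using assms unfolding screeners_iff by (metis image_eqI)
  qed
  ultimately show ?thesis using p by auto
qed

text \<open>The screener condition on \<open>\<alpha>\<close> says exactly that its reflection
  \<open>r\<close> maps \<open>L\<close> into itself. Being self-adjoint and involutive,
  \<open>r\<close> is an isometry, and it commutes with doubling, so each condition on
  \<open>\<beta>\<close> passes to \<open>r \<beta>\<close>.\<close>

lemma screeners_reflection:
  fixes \<alpha> \<beta> :: "'a::real_inner"
  assumes "\<alpha> \<in> screeners L" "\<beta> \<in> screeners L"
    and closed: "\<And>x y (k::int). x \<in> L \<Longrightarrow> y \<in> L \<Longrightarrow> x - of_int k *\<^sub>R y \<in> L"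
  shows "\<beta> - (2 * (\<beta> \<bullet> \<alpha>) / (\<alpha> \<bullet> \<alpha>)) *\<^sub>R \<alpha> \<in> screeners L"
proof -
  define r where "r x = x - (2 * (x \<bullet> \<alpha>) / (\<alpha> \<bullet> \<alpha>)) *\<^sub>R \<alpha>" for x
  have r_L: "r x \<in> L" if "x \<in> L" for x
  proof -
    have "2 * (x \<bullet> \<alpha>) / (\<alpha> \<bullet> \<alpha>) \<in> \<int>" using assms(1) that by (auto simp: screeners_iff)
    then obtain k where "2 * (x \<bullet> \<alpha>) / (\<alpha> \<bullet> \<alpha>) = of_int k" by (auto elim: Ints_cases)
    then show ?thesis
      using closed[of x \<alpha> k] that assms(1) by (simp add: r_def screeners_iff)
  qed
  have r_inner: "r x \<bullet> y = x \<bullet> r y" for x y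
    by (simp add: r_def inner_diff_left inner_diff_right inner_commute)
  have r_r: "r (r x) = x" for x
    by (cases "\<alpha> = 0") (simp_all add: r_def inner_diff_left algebra_simps)
  have r_scale: "r (2 *\<^sub>R x) = 2 *\<^sub>R r x" for x
    by (simp add: r_def algebra_simps)
  have norm: "r \<beta> \<bullet> r \<beta> = \<beta> \<bullet> \<beta>" by (simp add: r_inner r_r)
  have "r \<beta> \<notin> (*\<^sub>R) 2 ` L"
  proof
    assume "r \<beta> \<in> (*\<^sub>R) 2 ` L"
    then obtain x where "x \<in> L" "r \<beta> = 2 *\<^sub>R x" by blast
    then have "\<beta> = 2 *\<^sub>R r x" "r x \<in> L" using r_r[of \<beta>] r_scale[of x] r_L by auto
    then show False using assms(2) by (auto simp: screeners_iff)
  qed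
  moreover have "2 * (x \<bullet> r \<beta>) / (r \<beta> \<bullet> r \<beta>) \<in> \<int>" if "x \<in> L" for x
    using assms(2) r_L[OF that] unfolding norm screeners_iff r_inner[of x \<beta>, symmetric] by blast
  ultimately have "r \<beta> \<in> screeners L"
    using assms(2) r_L norm by (auto simp: screeners_iff)
  then show ?thesis by (simp add: r_def)
qed

section \<open>Screeners of a root lattice in coordinates\<close>

context
  fixes A :: "nat \<Rightarrow> nat \<Rightarrow> int" and n :: nat and \<alpha> :: "nat \<Rightarrow> 'a::real_inner" and L :: "'a set"
  assumes root_lattice: "root_lattice A n \<alpha> L"
begin

lemma root_lattice_eq: "L = {\<Sum>i=1..n. of_int (b i) *\<^sub>R \<alpha> i | b. True}"
  using root_lattice int_span_finite_image[of "{1..n}" \<alpha>] by (simp add: root_lattice_def)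

lemma root_lattice_gen: "i \<in> {1..n} \<Longrightarrow> \<alpha> i \<in> L"
  using root_lattice module.span_base[OF module_scaleR_of_int, of "\<alpha> i" "\<alpha> ` {1..n}"]
  by (simp add: root_lattice_def int_span_def)

lemma root_lattice_diff_scale: "x \<in> L \<Longrightarrow> y \<in> L \<Longrightarrow> x - of_int k *\<^sub>R y \<in> L"
  using root_lattice
  by (auto simp: root_lattice_def int_span_def
      intro!: module.span_diff[OF module_scaleR_of_int] module.span_scale[OF module_scaleR_of_int])

lemma inner_simple_comb:
  assumes "i \<in> {1..n}"
  shows "\<alpha> i \<bullet> (\<Sum>j=1..n. of_int (b j) *\<^sub>R \<alpha> j) = of_int (\<Sum>j=1..n. A i j * b j)"
proof -
  have "\<alpha> i \<bullet> (\<Sum>j=1..n. of_int (b j) *\<^sub>R \<alpha> j) = (\<Sum>j=1..n. of_int (b j) * (\<alpha> i \<bullet> \<alpha> j))"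
    by (simp add: inner_sum_right)
  also have "\<dots> = (\<Sum>j=1..n. of_int (A i j * b j))"
    using root_lattice assms by (intro sum.cong) (auto simp: root_lattice_def)
  finally show ?thesis by simp
qed

lemma inner_comb_comb:
  "(\<Sum>i=1..n. of_int (a i) *\<^sub>R \<alpha> i) \<bullet> (\<Sum>j=1..n. of_int (b j) *\<^sub>R \<alpha> j) =
     of_int (\<Sum>i=1..n. a i * (\<Sum>j=1..n. A i j * b j))"
proof -
  have "(\<Sum>i=1..n. of_int (a i) *\<^sub>R \<alpha> i) \<bullet> (\<Sum>j=1..n. of_int (b j) *\<^sub>R \<alpha> j) =
      (\<Sum>i=1..n. of_int (a i) * (\<alpha> i \<bullet> (\<Sum>j=1..n. of_int (b j) *\<^sub>R \<alpha> j)))"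
    by (simp add: inner_sum_left)
  also have "\<dots> = (\<Sum>i=1..n. of_int (a i * (\<Sum>j=1..n. A i j * b j)))"
    by (intro sum.cong refl) (simp only: inner_simple_comb of_int_mult)
  finally show ?thesis by simp
qed

lemma root_lattice_inner_Ints: "x \<in> L \<Longrightarrow> y \<in> L \<Longrightarrow> x \<bullet> y \<in> \<int>"
  by (auto simp: root_lattice_eq inner_comb_comb simp del: of_int_sum of_int_mult One_nat_def)

text \<open>For norm 2 the vector \<open>2 \<beta> / (\<beta> \<bullet> \<beta>)\<close> is
  \<open>\<beta>\<close> itself, so integrality of the form suffices; and
  \<open>\<beta> = 2 x\<close> would give \<open>4 (x \<bullet> x) = 2\<close>.\<close>

lemma lattice_roots_subset_screeners: "lattice_roots L \<subseteq> screeners L"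
proof
  fix \<beta> assume "\<beta> \<in> lattice_roots L"
  then have \<beta>: "\<beta> \<in> L" "\<beta> \<bullet> \<beta> = 2" by (auto simp: lattice_roots_def)
  have "\<beta> \<notin> (*\<^sub>R) 2 ` L"
  proof
    assume "\<beta> \<in> (*\<^sub>R) 2 ` L"
    then obtain x where x: "x \<in> L" "\<beta> = 2 *\<^sub>R x" by blast
    obtain k where "x \<bullet> x = of_int k" using root_lattice_inner_Ints[OF x(1) x(1)] by (auto elim: Ints_cases)
    then have "real_of_int (4 * k) = 2" using \<beta>(2) x(2) by simp
    then have "4 * k = 2" by linarith
    then show False by presburger
  qed
  then show "\<beta> \<in> screeners L"
    using \<beta> root_lattice_inner_Ints by (auto simp: screeners_iff intro!: exI[of _ 1])
qed

text \<open>Turns a screener into integer data, so that the classification becomes arithmetic. The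
  divisibility is the screener condition tested on the simple roots, and \<open>M\<close> is
  positive because 0 lies in \<open>2 L\<close>.\<close>

lemma screenerE:
  assumes "\<beta> \<in> screeners L"
  obtains b M where "\<beta> = (\<Sum>i=1..n. of_int (b i) *\<^sub>R \<alpha> i)" "\<beta> \<bullet> \<beta> = 2 * of_int M" "0 < M"
    "(\<Sum>i=1..n. b i * (\<Sum>j=1..n. A i j * b j)) = 2 * M"
    "\<forall>i\<in>{1..n}. M dvd (\<Sum>j=1..n. A i j * b j)"
proof -
  obtain M where M: "\<beta> \<bullet> \<beta> = 2 * of_int M" and "\<beta> \<in> L" and "\<beta> \<notin> (*\<^sub>R) 2 ` L"
    and int: "\<And>x. x \<in> L \<Longrightarrow> 2 * (x \<bullet> \<beta>) / (\<beta> \<bullet> \<beta>) \<in> \<int>"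
    using assms by (auto simp: screeners_iff)
  obtain b where b: "\<beta> = (\<Sum>i=1..n. of_int (b i) *\<^sub>R \<alpha> i)"
    using \<open>\<beta> \<in> L\<close> by (auto simp: root_lattice_eq)
  have "0 \<in> L" using root_lattice_diff_scale[of \<beta> \<beta> 1] \<open>\<beta> \<in> L\<close> by simp
  then have "\<beta> \<noteq> 0" using \<open>\<beta> \<notin> (*\<^sub>R) 2 ` L\<close> by (auto simp: image_iff)
  then have "0 < M" using M by (metis inner_gt_zero_iff of_int_0_less_iff zero_less_mult_pos zero_less_numeral)
  have "real_of_int (\<Sum>i=1..n. b i * (\<Sum>j=1..n. A i j * b j)) = of_int (2 * M)"
    using M inner_comb_comb[of b b] unfolding b by simp
  then have norm: "(\<Sum>i=1..n. b i * (\<Sum>j=1..n. A i j * b j)) = 2 * M"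
    by (simp only: of_int_eq_iff)
  have "M dvd (\<Sum>j=1..n. A i j * b j)" if i: "i \<in> {1..n}" for i
  proof -
    obtain k where "2 * (\<alpha> i \<bullet> \<beta>) / (\<beta> \<bullet> \<beta>) = of_int k"
      using int[OF root_lattice_gen[OF i]] by (auto elim: Ints_cases)
    then have "\<alpha> i \<bullet> \<beta> = of_int (M * k)" using M \<open>0 < M\<close> by (simp add: field_simps)
    then have "of_int (\<Sum>j=1..n. A i j * b j) = real_of_int (M * k)"
      using inner_simple_comb[OF i, of b] b by simp
    then have "(\<Sum>j=1..n. A i j * b j) = M * k" by (simp only: of_int_eq_iff)
    then show ?thesis by simp
  qed
  then show ?thesis using that b M \<open>0 < M\<close> norm by blast
qed

lemma screeners_eq_lattice_rootsI:
  assumes "\<And>b M. 0 < M \<Longrightarrow> (\<Sum>i=1..n. b i * (\<Sum>j=1..n. A i j * b j)) = 2 * M \<Longrightarrow>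
      (\<And>i. i \<in> {1..n} \<Longrightarrow> M dvd (\<Sum>j=1..n. A i j * b j)) \<Longrightarrow> M = 1"
  shows "screeners L = lattice_roots L"
proof
  show "screeners L \<subseteq> lattice_roots L"
  proof
    fix \<beta> assume \<beta>: "\<beta> \<in> screeners L"
    obtain b M where "\<beta> = (\<Sum>i=1..n. of_int (b i) *\<^sub>R \<alpha> i)" "\<beta> \<bullet> \<beta> = 2 * of_int M" "0 < M"
      "(\<Sum>i=1..n. b i * (\<Sum>j=1..n. A i j * b j)) = 2 * M"
      "\<forall>i\<in>{1..n}. M dvd (\<Sum>j=1..n. A i j * b j)"
      by (rule screenerE[OF \<beta>])
    with assms[of M b] \<beta> show "\<beta> \<in> lattice_roots L"
      by (simp add: lattice_roots_def screeners_iff)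
  qed
qed (rule lattice_roots_subset_screeners)

end

section \<open>Norms of screeners in type \<open>A\<close>\<close>

text \<open>Padding \<open>b\<close> by zeros at \<open>0\<close> and \<open>n + 1\<close> gives the
  two end rows the same form as the inner ones, a negated second difference.\<close>

lemma sum_cartan_A:
  assumes "i \<in> {1..n}" "b 0 = 0" "b (n + 1) = 0"
  shows "(\<Sum>j=1..n. cartan_A i j * b j) = (b i - b (i - 1)) - (b (i + 1) - b i)"
proof -
  \<comment> \<open>For \<open>i = 1\<close> the index \<open>i - 1\<close> is 0, outside the range
    of summation, so the last term contributes nothing, in accordance with
    \<open>b 0 = 0\<close>.\<close>
  have "(\<Sum>j=1..n. cartan_A i j * b j) =
      (\<Sum>j=1..n. (if j = i then 2 * b j else 0) - (if j = i + 1 then b j else 0)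
        - (if j = i - 1 then b j else 0))"
    using assms(1) by (intro sum.cong) (auto simp: cartan_A_def)
  also have "\<dots> = 2 * b i - b (i + 1) - b (i - 1)"
    using assms by (cases "i = n"; cases "i = 1") (auto simp: sum_subtractf)
  finally show ?thesis by simp
qed

text \<open>Summation by parts. If also \<open>b (n + 1) = 0\<close>, the boundary term is the
  square of the difference number \<open>n + 1\<close>, so the norm becomes a sum of
  \<open>n + 1\<close> squares.\<close>

lemma sum_by_parts_differences:
  fixes b :: "nat \<Rightarrow> int"
  assumes "b 0 = 0"
  shows "(\<Sum>i=1..n. b i * ((b i - b (i - 1)) - (b (i + 1) - b i))) =
    (\<Sum>i=1..n. (b i - b (i - 1))\<^sup>2) - b n * (b (n + 1) - b n)"
proof (induction n)
  case 0
  then show ?case using assms by simp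
next
  case (Suc n)
  then show ?case by (simp add: power2_eq_square algebra_simps)
qed

lemma zero_sum_congruent_square_sum:
  fixes x :: "nat \<Rightarrow> int"
  assumes "3 \<le> n" "0 < M"
    and sum0: "(\<Sum>i=1..n + 1. x i) = 0"
    and sq: "(\<Sum>i=1..n + 1. (x i)\<^sup>2) = 2 * M"
    and cong: "\<And>i j. i \<in> {1..n + 1} \<Longrightarrow> j \<in> {1..n + 1} \<Longrightarrow> M dvd x i - x j"
  shows "M = 1 \<or> (M = 2 \<and> n = 3)"
proof -
  let ?I = "{1..n + 1}"
  have split: "sum f ?I = f i + f j + sum f (?I - {i, j})"
    if "i \<in> ?I" "j \<in> ?I" "i \<noteq> j" for i j and f :: "nat \<Rightarrow> int"
    using that sum.remove[of ?I i f] sum.remove[of "?I - {i}" j f]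
    by (simp add: Diff_insert2[symmetric] insert_commute del: One_nat_def sum.cl_ivl_Suc)
  have pos: "\<exists>i\<in>?I. 0 < y i" if y: "(\<Sum>i\<in>?I. y i) = 0" "k \<in> ?I" "y k \<noteq> 0" for k and y :: "nat \<Rightarrow> int"
  proof (rule ccontr)
    assume "\<not> (\<exists>i\<in>?I. 0 < y i)"
    then have "\<forall>i\<in>?I. 0 \<le> - y i" by (auto simp: not_less)
    moreover have "(\<Sum>i\<in>?I. - y i) = 0" using y(1) by (simp add: sum_negf)
    ultimately have "\<forall>i\<in>?I. - y i = 0" using sum_nonneg_eq_0_iff[of ?I "\<lambda>i. - y i"] by simp
    then show False using y(2,3) by auto
  qed
  obtain k where k: "k \<in> ?I" "x k \<noteq> 0"
  proof (rule ccontr)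
    assume "\<not> thesis"
    then have "\<forall>i\<in>?I. x i = 0" using that by blast
    then have "(\<Sum>i\<in>?I. (x i)\<^sup>2) = 0" by simp
    then show False using sq \<open>0 < M\<close> by simp
  qed
  obtain i where i: "i \<in> ?I" "0 < x i" using pos[OF sum0 k] by blast
  obtain j where j: "j \<in> ?I" "x j < 0"
    using pos[of "\<lambda>i. - x i" k] sum0 k by (auto simp: sum_negf)
  have ij: "i \<noteq> j" using i j by auto
  note sq' = split[OF i(1) j(1) ij, of "\<lambda>i. (x i)\<^sup>2", unfolded sq]
  show ?thesis
  proof (cases "\<exists>l\<in>?I. x l = 0")
    \<comment> \<open>One zero entry makes every entry a multiple of \<open>M\<close>; the entries
      at \<open>i\<close> and \<open>j\<close> alone then give
      \<open>2 * M\<^sup>2 \<le> 2 * M\<close>.\<close>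
    case True
    then obtain l where l: "l \<in> ?I" "x l = 0" by blast
    have "M \<le> x i" "M \<le> - x j"
      using cong[OF i(1) l(1)] cong[OF l(1) j(1)] l i j by (auto intro: zdvd_imp_le)
    then have "M\<^sup>2 \<le> (x i)\<^sup>2" "M\<^sup>2 \<le> (x j)\<^sup>2"
      using power_mono[of M "x i" 2] power_mono[of M "- x j" 2] \<open>0 < M\<close> by auto
    moreover have "0 \<le> (\<Sum>i\<in>?I - {i, j}. (x i)\<^sup>2)" by (simp add: sum_nonneg)
    ultimately have "M * M \<le> M * 1" using sq' by (simp add: power2_eq_square)
    then show ?thesis using \<open>0 < M\<close> by simp
  next
    case False
    have one: "1 \<le> (x l)\<^sup>2" if "l \<in> ?I" for l
      using False that by (simp add: int_one_le_iff_zero_less)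
    have "card (?I - {i, j}) = n - 1" using i j ij by (simp add: card_Diff_subset)
    then have rest: "int (n - 1) \<le> (\<Sum>i\<in>?I - {i, j}. (x i)\<^sup>2)"
      using sum_mono[of "?I - {i, j}" "\<lambda>_. 1" "\<lambda>i. (x i)\<^sup>2"] one by simp
    \<comment> \<open>The square of the difference is at most twice the sum of the two squares, and
      the remaining \<open>n - 1\<close> nonzero entries use up at least \<open>n - 1\<close> of the
      total \<open>2 * M\<close>.\<close>
    have "M \<le> x i - x j" using cong[OF i(1) j(1)] i j by (auto intro: zdvd_imp_le)
    then have "M\<^sup>2 \<le> (x i - x j)\<^sup>2" using power_mono[of M "x i - x j" 2] \<open>0 < M\<close> by simp
    also have "\<dots> \<le> (x i - x j)\<^sup>2 + (x i + x j)\<^sup>2" by simp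
    also have "\<dots> = 2 * ((x i)\<^sup>2 + (x j)\<^sup>2)" by (simp add: power2_eq_square algebra_simps)
    also have "\<dots> = 2 * (2 * M - (\<Sum>i\<in>?I - {i, j}. (x i)\<^sup>2))" using sq' by simp
    also have "\<dots> \<le> 2 * (2 * M - int (n - 1))" using rest by simp
    finally have "M\<^sup>2 + 2 * int (n - 1) \<le> 4 * M" by simp
    then have *: "(M - 2)\<^sup>2 + 2 * (int n - 3) \<le> 0"
      using \<open>3 \<le> n\<close> by (simp add: power2_eq_square algebra_simps)
    have "2 * (int n - 3) \<le> (M - 2)\<^sup>2 + 2 * (int n - 3)" by simp
    from order.trans[OF this *] have "int n \<le> 3" by simp
    then have "n = 3" using \<open>3 \<le> n\<close> by simp
    with * show ?thesis by simp
  qed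
qed

text \<open>In the model of \<open>A_n\<close> by integer vectors of coordinate sum 0, with
  \<open>\<alpha> i = e_i - e_(i+1)\<close>, the numbers \<open>x i\<close> are the standard
  coordinates. Row \<open>i\<close> of the Gram matrix yields \<open>x i - x (i + 1)\<close>, so
  divisibility of the rows means congruence of neighbours.\<close>

lemma screener_norm_A:
  assumes "3 \<le> n" "0 < M"
    and norm: "(\<Sum>i=1..n. b i * (\<Sum>j=1..n. cartan_A i j * b j)) = 2 * M"
    and dvd: "\<And>i. i \<in> {1..n} \<Longrightarrow> M dvd (\<Sum>j=1..n. cartan_A i j * b j)"
  shows "M = 1 \<or> (M = 2 \<and> n = 3)"
proof -
  \<comment> \<open>\<open>b\<close> is arbitrary outside \<open>{1..n}\<close>; \<open>c\<close>
    supplies the zero boundary values.\<close>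
  define c where "c i = (if i \<in> {1..n} then b i else 0)" for i
  define x where "x i = c i - c (i - 1)" for i
  have c0: "c 0 = 0" "c (n + 1) = 0" by (simp_all add: c_def)
  have row: "(\<Sum>j=1..n. cartan_A i j * b j) = x i - x (i + 1)" if "i \<in> {1..n}" for i
  proof -
    have "(\<Sum>j=1..n. cartan_A i j * b j) = (\<Sum>j=1..n. cartan_A i j * c j)"
      by (intro sum.cong) (auto simp: c_def)
    then show ?thesis using sum_cartan_A[OF that, of c] c0 by (simp add: x_def)
  qed
  have "2 * M = (\<Sum>i=1..n. c i * (x i - x (i + 1)))"
    unfolding norm[symmetric] by (intro sum.cong refl) (simp add: row c_def del: One_nat_def)
  also have "\<dots> = (\<Sum>i=1..n + 1. (x i)\<^sup>2)"
    using sum_by_parts_differences[of c n] c0 by (simp add: x_def power2_eq_square)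
  finally have sq: "(\<Sum>i=1..n + 1. (x i)\<^sup>2) = 2 * M" by simp
  have "(\<Sum>i=1..m. x i) = c m" for m
    by (induction m) (simp_all add: x_def c_def)
  then have sum0: "(\<Sum>i=1..n + 1. x i) = 0" using c0 by metis
  have "M dvd x 1 - x (Suc i)" if "i \<le> n" for i
    using that
  proof (induction i)
    case (Suc i)
    then have "M dvd (x 1 - x (Suc i)) + (x (Suc i) - x (Suc i + 1))"
      using dvd[of "Suc i"] row[of "Suc i"] by (intro dvd_add) auto
    then show ?case by simp
  qed simp
  then have x1: "M dvd x 1 - x i" if "i \<in> {1..n + 1}" for i
    using that by (cases i) auto
  have "M dvd x i - x j" if "i \<in> {1..n + 1}" "j \<in> {1..n + 1}" for i j
    using dvd_diff[OF x1[OF that(2)] x1[OF that(1)]] by simp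
  then show ?thesis using zero_sum_congruent_square_sum[OF assms(1,2) sum0 sq] by blast
qed


section \<open>Norms of screeners in type \<open>E\<close>\<close>

text \<open>Replaces sets of unordered pairs by equations that simplification decides at
  numerals.\<close>

lemma cartan_E_simp:
  "cartan_E i j =
    (if i = j then 2
     else if i = 1 \<and> j = 3 \<or> i = 3 \<and> j = 1 \<or> i = 2 \<and> j = 4 \<or> i = 4 \<and> j = 2 \<or>
       3 \<le> i \<and> j = i + 1 \<or> 3 \<le> j \<and> i = j + 1 then -1
     else 0)"
  unfolding cartan_E_def by (auto simp: doubleton_eq_iff)

text \<open>\<open>E_8\<close> is unimodular, so \<open>b\<close> itself is divisible by
  \<open>M\<close>. The form is quadratic, hence \<open>M\<^sup>2\<close> divides half the norm,
  which is \<open>M\<close>.\<close>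

lemma screener_norm_E8:
  assumes "0 < M"
    and norm: "(\<Sum>i=1..8. b i * (\<Sum>j=1..8. cartan_E i j * b j)) = 2 * M"
    and dvd: "\<And>i. i \<in> {1..8} \<Longrightarrow> M dvd (\<Sum>j=1..8. cartan_E i j * b j)"
  shows "M = 1"
proof -
  have I: "{Suc 0..8} = {1,2,3,4,5,6,7,8}" by auto
  obtain d where "\<forall>i\<in>{1..8}. (\<Sum>j=1..8. cartan_E i j * b j) = M * d i"
    using dvd unfolding dvd_def by metis
  then have d:
    "M * d 1 = 2 * b 1 - b 3" "M * d 2 = 2 * b 2 - b 4" "M * d 3 = 2 * b 3 - b 1 - b 4"
    "M * d 4 = 2 * b 4 - b 2 - b 3 - b 5" "M * d 5 = 2 * b 5 - b 4 - b 6"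
    "M * d 6 = 2 * b 6 - b 5 - b 7" "M * d 7 = 2 * b 7 - b 6 - b 8" "M * d 8 = 2 * b 8 - b 7"
    by (simp_all add: I cartan_E_simp)
  \<comment> \<open>Half the norm: one square per node and one cross term per edge of the
    diagram.\<close>
  have q: "M = (b 1)\<^sup>2 + (b 2)\<^sup>2 + (b 3)\<^sup>2 + (b 4)\<^sup>2 + (b 5)\<^sup>2 + (b 6)\<^sup>2 + (b 7)\<^sup>2 + (b 8)\<^sup>2
      - b 1 * b 3 - b 2 * b 4 - b 3 * b 4 - b 4 * b 5 - b 5 * b 6 - b 6 * b 7 - b 7 * b 8"
    using norm by (simp add: I cartan_E_simp power2_eq_square algebra_simps)
  \<comment> \<open>The coefficients are the rows of the inverse Cartan matrix.\<close>
  define u1 where "u1 = 4 * d 1 + 5 * d 2 + 7 * d 3 + 10 * d 4 + 8 * d 5 + 6 * d 6 + 4 * d 7 + 2 * d 8"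
  define u2 where "u2 = 5 * d 1 + 8 * d 2 + 10 * d 3 + 15 * d 4 + 12 * d 5 + 9 * d 6 + 6 * d 7 + 3 * d 8"
  define u3 where "u3 = 7 * d 1 + 10 * d 2 + 14 * d 3 + 20 * d 4 + 16 * d 5 + 12 * d 6 + 8 * d 7 + 4 * d 8"
  define u4 where "u4 = 10 * d 1 + 15 * d 2 + 20 * d 3 + 30 * d 4 + 24 * d 5 + 18 * d 6 + 12 * d 7 + 6 * d 8"
  define u5 where "u5 = 8 * d 1 + 12 * d 2 + 16 * d 3 + 24 * d 4 + 20 * d 5 + 15 * d 6 + 10 * d 7 + 5 * d 8"
  define u6 where "u6 = 6 * d 1 + 9 * d 2 + 12 * d 3 + 18 * d 4 + 15 * d 5 + 12 * d 6 + 8 * d 7 + 4 * d 8"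
  define u7 where "u7 = 4 * d 1 + 6 * d 2 + 8 * d 3 + 12 * d 4 + 10 * d 5 + 8 * d 6 + 6 * d 7 + 3 * d 8"
  define u8 where "u8 = 2 * d 1 + 3 * d 2 + 4 * d 3 + 6 * d 4 + 5 * d 5 + 4 * d 6 + 3 * d 7 + 2 * d 8"
  have b: "b 1 = M * u1" "b 2 = M * u2" "b 3 = M * u3" "b 4 = M * u4"
    "b 5 = M * u5" "b 6 = M * u6" "b 7 = M * u7" "b 8 = M * u8"
    using d unfolding u1_def u2_def u3_def u4_def u5_def u6_def u7_def u8_def
    by (simp_all add: distrib_left mult.left_commute[of M])
  have "M = M * (M * (u1\<^sup>2 + u2\<^sup>2 + u3\<^sup>2 + u4\<^sup>2 + u5\<^sup>2 + u6\<^sup>2 + u7\<^sup>2 + u8\<^sup>2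
      - u1 * u3 - u2 * u4 - u3 * u4 - u4 * u5 - u5 * u6 - u6 * u7 - u7 * u8))"
    using q unfolding b by (simp add: power2_eq_square algebra_simps)
  then have "M dvd 1" using \<open>0 < M\<close> by (metis dvd_triv_left less_irrefl mult_cancel_left2 mult.right_neutral)
  then show ?thesis using \<open>0 < M\<close> by simp
qed

text \<open>The Cartan matrix has determinant 2, so only \<open>2 b\<close> is a multiple
  \<open>M u\<close>, which leads to \<open>M * Q = 4\<close> for the halved form \<open>Q\<close>
  at \<open>u\<close>. Since \<open>Q\<close> is 0 or 3 modulo 4 and 3 does not divide 4,
  \<open>Q = 4\<close>.\<close>

lemma screener_norm_E7:
  assumes "0 < M"
    and norm: "(\<Sum>i=1..7. b i * (\<Sum>j=1..7. cartan_E i j * b j)) = 2 * M"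
    and dvd: "\<And>i. i \<in> {1..7} \<Longrightarrow> M dvd (\<Sum>j=1..7. cartan_E i j * b j)"
  shows "M = 1"
proof -
  have I: "{Suc 0..7} = {1,2,3,4,5,6,7}" by auto
  obtain d where "\<forall>i\<in>{1..7}. (\<Sum>j=1..7. cartan_E i j * b j) = M * d i"
    using dvd unfolding dvd_def by metis
  then have d:
    "M * d 1 = 2 * b 1 - b 3" "M * d 2 = 2 * b 2 - b 4" "M * d 3 = 2 * b 3 - b 1 - b 4"
    "M * d 4 = 2 * b 4 - b 2 - b 3 - b 5" "M * d 5 = 2 * b 5 - b 4 - b 6"
    "M * d 6 = 2 * b 6 - b 5 - b 7" "M * d 7 = 2 * b 7 - b 6"
    by (simp_all add: I cartan_E_simp)
  have q: "M = (b 1)\<^sup>2 + (b 2)\<^sup>2 + (b 3)\<^sup>2 + (b 4)\<^sup>2 + (b 5)\<^sup>2 + (b 6)\<^sup>2 + (b 7)\<^sup>2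
      - b 1 * b 3 - b 2 * b 4 - b 3 * b 4 - b 4 * b 5 - b 5 * b 6 - b 6 * b 7"
    using norm by (simp add: I cartan_E_simp power2_eq_square algebra_simps)
  \<comment> \<open>The coefficients are the rows of \<open>2 A\<^sup>-\<^sup>1\<close>, where \<open>A\<close> is the Cartan matrix.\<close>
  define u1 where "u1 = 4 * d 1 + 4 * d 2 + 6 * d 3 + 8 * d 4 + 6 * d 5 + 4 * d 6 + 2 * d 7"
  define u2 where "u2 = 4 * d 1 + 7 * d 2 + 8 * d 3 + 12 * d 4 + 9 * d 5 + 6 * d 6 + 3 * d 7"
  define u3 where "u3 = 6 * d 1 + 8 * d 2 + 12 * d 3 + 16 * d 4 + 12 * d 5 + 8 * d 6 + 4 * d 7"
  define u4 where "u4 = 8 * d 1 + 12 * d 2 + 16 * d 3 + 24 * d 4 + 18 * d 5 + 12 * d 6 + 6 * d 7"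
  define u5 where "u5 = 6 * d 1 + 9 * d 2 + 12 * d 3 + 18 * d 4 + 15 * d 5 + 10 * d 6 + 5 * d 7"
  define u6 where "u6 = 4 * d 1 + 6 * d 2 + 8 * d 3 + 12 * d 4 + 10 * d 5 + 8 * d 6 + 4 * d 7"
  define u7 where "u7 = 2 * d 1 + 3 * d 2 + 4 * d 3 + 6 * d 4 + 5 * d 5 + 4 * d 6 + 3 * d 7"
  define Q where "Q = u1\<^sup>2 + u2\<^sup>2 + u3\<^sup>2 + u4\<^sup>2 + u5\<^sup>2 + u6\<^sup>2 + u7\<^sup>2
      - u1 * u3 - u2 * u4 - u3 * u4 - u4 * u5 - u5 * u6 - u6 * u7"
  have b: "2 * b 1 = M * u1" "2 * b 2 = M * u2" "2 * b 3 = M * u3" "2 * b 4 = M * u4"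
    "2 * b 5 = M * u5" "2 * b 6 = M * u6" "2 * b 7 = M * u7"
    using d unfolding u1_def u2_def u3_def u4_def u5_def u6_def u7_def
    by (simp_all add: distrib_left mult.left_commute[of M])
  have "4 * M = (2 * b 1)\<^sup>2 + (2 * b 2)\<^sup>2 + (2 * b 3)\<^sup>2 + (2 * b 4)\<^sup>2 + (2 * b 5)\<^sup>2 + (2 * b 6)\<^sup>2
      + (2 * b 7)\<^sup>2 - (2 * b 1) * (2 * b 3) - (2 * b 2) * (2 * b 4) - (2 * b 3) * (2 * b 4)
      - (2 * b 4) * (2 * b 5) - (2 * b 5) * (2 * b 6) - (2 * b 6) * (2 * b 7)"
    using q by (simp add: power2_eq_square)
  also have "\<dots> = M * (M * Q)"
    unfolding b by (simp add: Q_def power2_eq_square algebra_simps)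
  finally have MQ: "M * Q = 4" using \<open>0 < M\<close> by (simp add: mult.commute)
  \<comment> \<open>As \<open>A u = 2 d\<close>, the vector \<open>u\<close> reduces to the kernel of \<open>A\<close> modulo 2, which is spanned by
    \<open>(0, 1, 0, 0, 1, 0, 1)\<close>.\<close>
  define s where "s = d 2 + d 5 + d 7"
  have "\<exists>e1 e2 e3 e4 e5 e6 e7. u1 = 2 * e1 \<and> u2 = s + 2 * e2 \<and> u3 = 2 * e3 \<and> u4 = 2 * e4 \<and>
      u5 = s + 2 * e5 \<and> u6 = 2 * e6 \<and> u7 = s + 2 * e7"
    unfolding u1_def u2_def u3_def u4_def u5_def u6_def u7_def s_def by presburger
  then obtain e1 e2 e3 e4 e5 e6 e7 where u: "u1 = 2 * e1" "u2 = s + 2 * e2" "u3 = 2 * e3" "u4 = 2 * e4"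
      "u5 = s + 2 * e5" "u6 = 2 * e6" "u7 = s + 2 * e7"
    by blast
  \<comment> \<open>The 3 is the halved form at the kernel vector. The mixed terms carry a factor 4,
    one 2 from \<open>2 * e\<close> and one from the kernel property.\<close>
  have "Q = 3 * s\<^sup>2 + 4 * (e1\<^sup>2 + e2\<^sup>2 + e3\<^sup>2 + e4\<^sup>2 + e5\<^sup>2 + e6\<^sup>2 + e7\<^sup>2 + s * (e2 + e5 + e7)
      - e1 * e3 - e2 * e4 - e3 * e4 - e4 * e5 - e5 * e6 - e6 * e7 - s * e4 - s * e6)"
    unfolding Q_def u by (simp add: power2_eq_square algebra_simps)
  then obtain w where w: "Q = 3 * s\<^sup>2 + 4 * w" by blast
  have "0 < Q" using MQ \<open>0 < M\<close> by (metis zero_less_mult_pos zero_less_numeral)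
  moreover have "Q dvd 4" using MQ by (metis dvd_triv_right)
  ultimately have "Q \<in> {1,2,3,4}" using zdvd_imp_le[of Q 4] by auto
  moreover have "\<exists>k. s\<^sup>2 = 4 * k \<or> s\<^sup>2 = 4 * k + 1"
  proof -
    obtain t where "s = 2 * t \<or> s = 2 * t + 1" by (metis evenE oddE)
    then have "s\<^sup>2 = 4 * t\<^sup>2 \<or> s\<^sup>2 = 4 * (t\<^sup>2 + t) + 1" by (auto simp: power2_eq_square algebra_simps)
    then show ?thesis by blast
  qed
  then obtain k where "Q = 4 * (3 * k + w) \<or> Q = 4 * (3 * k + w) + 3" using w by force
  ultimately have "Q = 3 \<or> Q = 4" by auto presburger+
  with MQ show ?thesis by (auto; presburger)
qed

text \<open>As for \<open>E_7\<close>, now with determinant 3: \<open>M * Q = 9\<close>, where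
  \<open>Q\<close> is 0 or 6 modulo 9, and 6 does not divide 9.\<close>

lemma screener_norm_E6:
  assumes "0 < M"
    and norm: "(\<Sum>i=1..6. b i * (\<Sum>j=1..6. cartan_E i j * b j)) = 2 * M"
    and dvd: "\<And>i. i \<in> {1..6} \<Longrightarrow> M dvd (\<Sum>j=1..6. cartan_E i j * b j)"
  shows "M = 1"
proof -
  have I: "{Suc 0..6} = {1,2,3,4,5,6}" by auto
  obtain d where "\<forall>i\<in>{1..6}. (\<Sum>j=1..6. cartan_E i j * b j) = M * d i"
    using dvd unfolding dvd_def by metis
  then have d:
    "M * d 1 = 2 * b 1 - b 3" "M * d 2 = 2 * b 2 - b 4" "M * d 3 = 2 * b 3 - b 1 - b 4"
    "M * d 4 = 2 * b 4 - b 2 - b 3 - b 5" "M * d 5 = 2 * b 5 - b 4 - b 6"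
    "M * d 6 = 2 * b 6 - b 5"
    by (simp_all add: I cartan_E_simp)
  have q: "M = (b 1)\<^sup>2 + (b 2)\<^sup>2 + (b 3)\<^sup>2 + (b 4)\<^sup>2 + (b 5)\<^sup>2 + (b 6)\<^sup>2
      - b 1 * b 3 - b 2 * b 4 - b 3 * b 4 - b 4 * b 5 - b 5 * b 6"
    using norm by (simp add: I cartan_E_simp power2_eq_square algebra_simps)
  \<comment> \<open>The coefficients are the rows of \<open>3 A\<^sup>-\<^sup>1\<close>, where \<open>A\<close> is the Cartan matrix.\<close>
  define u1 where "u1 = 4 * d 1 + 3 * d 2 + 5 * d 3 + 6 * d 4 + 4 * d 5 + 2 * d 6"
  define u2 where "u2 = 3 * d 1 + 6 * d 2 + 6 * d 3 + 9 * d 4 + 6 * d 5 + 3 * d 6"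
  define u3 where "u3 = 5 * d 1 + 6 * d 2 + 10 * d 3 + 12 * d 4 + 8 * d 5 + 4 * d 6"
  define u4 where "u4 = 6 * d 1 + 9 * d 2 + 12 * d 3 + 18 * d 4 + 12 * d 5 + 6 * d 6"
  define u5 where "u5 = 4 * d 1 + 6 * d 2 + 8 * d 3 + 12 * d 4 + 10 * d 5 + 5 * d 6"
  define u6 where "u6 = 2 * d 1 + 3 * d 2 + 4 * d 3 + 6 * d 4 + 5 * d 5 + 4 * d 6"
  define Q where "Q = u1\<^sup>2 + u2\<^sup>2 + u3\<^sup>2 + u4\<^sup>2 + u5\<^sup>2 + u6\<^sup>2
      - u1 * u3 - u2 * u4 - u3 * u4 - u4 * u5 - u5 * u6"
  have b: "3 * b 1 = M * u1" "3 * b 2 = M * u2" "3 * b 3 = M * u3" "3 * b 4 = M * u4"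
    "3 * b 5 = M * u5" "3 * b 6 = M * u6"
    using d unfolding u1_def u2_def u3_def u4_def u5_def u6_def
    by (simp_all add: distrib_left mult.left_commute[of M])
  have "9 * M = (3 * b 1)\<^sup>2 + (3 * b 2)\<^sup>2 + (3 * b 3)\<^sup>2 + (3 * b 4)\<^sup>2 + (3 * b 5)\<^sup>2 + (3 * b 6)\<^sup>2
      - (3 * b 1) * (3 * b 3) - (3 * b 2) * (3 * b 4) - (3 * b 3) * (3 * b 4)
      - (3 * b 4) * (3 * b 5) - (3 * b 5) * (3 * b 6)"
    using q by (simp add: power2_eq_square)
  also have "\<dots> = M * (M * Q)"
    unfolding b by (simp add: Q_def power2_eq_square algebra_simps)
  finally have MQ: "M * Q = 9" using \<open>0 < M\<close> by (simp add: mult.commute)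
  \<comment> \<open>As \<open>A u = 3 d\<close>, the vector \<open>u\<close> reduces to the kernel of \<open>A\<close> modulo 3, which is spanned by
    \<open>(1, 0, 2, 0, 1, 2)\<close>.\<close>
  define s where "s = d 1 - d 3 + d 5 - d 6"
  have "\<exists>e1 e2 e3 e4 e5 e6. u1 = s + 3 * e1 \<and> u2 = 3 * e2 \<and> u3 = 2 * s + 3 * e3 \<and> u4 = 3 * e4 \<and>
      u5 = s + 3 * e5 \<and> u6 = 2 * s + 3 * e6"
    unfolding u1_def u2_def u3_def u4_def u5_def u6_def s_def by presburger
  then obtain e1 e2 e3 e4 e5 e6 where u: "u1 = s + 3 * e1" "u2 = 3 * e2" "u3 = 2 * s + 3 * e3"
      "u4 = 3 * e4" "u5 = s + 3 * e5" "u6 = 2 * s + 3 * e6"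
    by blast
  \<comment> \<open>The 6 is the halved form at the kernel vector; the mixed terms are multiples of
    9 by the kernel property modulo 3.\<close>
  have "Q = 6 * s\<^sup>2 + 9 * (e1\<^sup>2 + e2\<^sup>2 + e3\<^sup>2 + e4\<^sup>2 + e5\<^sup>2 + e6\<^sup>2
      - e1 * e3 - e2 * e4 - e3 * e4 - e4 * e5 - e5 * e6 + s * (e3 + e6 - e4))"
    unfolding Q_def u by (simp add: power2_eq_square algebra_simps)
  then obtain w where w: "Q = 6 * s\<^sup>2 + 9 * w" by blast
  have "0 < Q" using MQ \<open>0 < M\<close> by (metis zero_less_mult_pos zero_less_numeral)
  moreover have "Q dvd 9" using MQ by (metis dvd_triv_right)
  ultimately have "Q \<in> {1,2,3,4,5,6,7,8,9}" using zdvd_imp_le[of Q 9] by auto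
  moreover have "\<exists>k. s\<^sup>2 = 3 * k \<or> s\<^sup>2 = 3 * k + 1"
  proof -
    have "\<exists>t. s = 3 * t \<or> s = 3 * t + 1 \<or> s = 3 * t + 2" by presburger
    then obtain t where "s = 3 * t \<or> s = 3 * t + 1 \<or> s = 3 * t + 2" by blast
    then have "s\<^sup>2 = 3 * (3 * t\<^sup>2) \<or> s\<^sup>2 = 3 * (3 * t\<^sup>2 + 2 * t) + 1 \<or> s\<^sup>2 = 3 * (3 * t\<^sup>2 + 4 * t + 1) + 1"
      by (auto simp: power2_eq_square algebra_simps)
    then show ?thesis by blast
  qed
  then obtain k where "Q = 9 * (2 * k + w) \<or> Q = 9 * (2 * k + w) + 6" using w by force
  ultimately have "Q = 6 \<or> Q = 9" by auto presburger+
  with MQ show ?thesis by (auto; presburger)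
qed


section \<open>Roots and further screeners of \<open>A_3\<close>\<close>

text \<open>Coordinates by integer triples turn the finite sets of roots and screeners into explicit
  lists that can be checked entry by entry.\<close>

definition A3_vec :: "(nat \<Rightarrow> 'a::real_vector) \<Rightarrow> int \<times> int \<times> int \<Rightarrow> 'a" where
  "A3_vec \<alpha> = (\<lambda>(p, q, r). of_int p *\<^sub>R \<alpha> 1 + of_int q *\<^sub>R \<alpha> 2 + of_int r *\<^sub>R \<alpha> 3)"

lemma int_square_le_bounds:
  fixes x :: int
  shows "x\<^sup>2 \<le> 2 \<Longrightarrow> x \<in> {-1, 0, 1}" and "x\<^sup>2 \<le> 4 \<Longrightarrow> x \<in> {-2, -1, 0, 1, 2}"
proof -
  show "x \<in> {-1, 0, 1}" if "x\<^sup>2 \<le> 2"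
    using that power2_less_imp_less[of "\<bar>x\<bar>" 2] by auto
  show "x \<in> {-2, -1, 0, 1, 2}" if "x\<^sup>2 \<le> 4"
    using that power2_less_imp_less[of "\<bar>x\<bar>" 3] by auto
qed

text \<open>The left side is the norm in the coordinates \<open>p\<close>, \<open>q - p\<close>,
  \<open>r - q\<close>, \<open>- r\<close> of the sum-zero model. Each square is bounded by 2, which
  leaves a finite search over the first two and \<open>r\<close>.\<close>

lemma A3_norm_2_cases:
  fixes p q r :: int
  assumes "p\<^sup>2 + (q - p)\<^sup>2 + (r - q)\<^sup>2 + r\<^sup>2 = 2"
  shows "(p, q, r) \<in> {(1,0,0), (0,1,0), (0,0,1), (1,1,0), (0,1,1), (1,1,1),
    (-1,0,0), (0,-1,0), (0,0,-1), (-1,-1,0), (0,-1,-1), (-1,-1,-1)}"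
proof -
  have nonneg: "0 \<le> p\<^sup>2" "0 \<le> (q - p)\<^sup>2" "0 \<le> (r - q)\<^sup>2" "0 \<le> r\<^sup>2" by simp_all
  define t where "t = q - p"
  have "p\<^sup>2 \<le> 2" "t\<^sup>2 \<le> 2" "r\<^sup>2 \<le> 2" unfolding t_def using assms nonneg by linarith+
  then have "p \<in> {-1, 0, 1}" "t \<in> {-1, 0, 1}" "r \<in> {-1, 0, 1}"
    by (simp_all only: int_square_le_bounds(1))
  moreover have "q = p + t" by (simp add: t_def)
  ultimately show ?thesis using assms by (elim insertE emptyE; simp)
qed

text \<open>A single coordinate of absolute value 2 violates the zero sum, so the solutions have two
  coordinates 1 and two coordinates -1.\<close>

lemma A3_norm_4_cases:
  fixes p q r :: int
  assumes "p\<^sup>2 + (q - p)\<^sup>2 + (r - q)\<^sup>2 + r\<^sup>2 = 4"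
  shows "(p, q, r) \<in> {(1,0,1), (-1,0,-1), (1,0,-1), (-1,0,1), (1,2,1), (-1,-2,-1)}"
proof -
  have nonneg: "0 \<le> p\<^sup>2" "0 \<le> (q - p)\<^sup>2" "0 \<le> (r - q)\<^sup>2" "0 \<le> r\<^sup>2" by simp_all
  define t where "t = q - p"
  have "p\<^sup>2 \<le> 4" "t\<^sup>2 \<le> 4" "r\<^sup>2 \<le> 4" unfolding t_def using assms nonneg by linarith+
  then have "p \<in> {-2, -1, 0, 1, 2}" "t \<in> {-2, -1, 0, 1, 2}" "r \<in> {-2, -1, 0, 1, 2}"
    by (simp_all only: int_square_le_bounds(2))
  moreover have "q = p + t" by (simp add: t_def)
  ultimately show ?thesis using assms by (elim insertE emptyE; simp)
qed

lemma A3_extra_screeners_eq: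
  "A3_extra_screeners \<alpha> =
    A3_vec \<alpha> ` {(1,0,1), (-1,0,-1), (1,0,-1), (-1,0,1), (1,2,1), (-1,-2,-1)}"
  by (simp add: A3_extra_screeners_def A3_vec_def minus_diff_commute)

context
  fixes \<alpha> :: "nat \<Rightarrow> 'a::real_inner" and L :: "'a set"
  assumes A3: "root_lattice cartan_A 3 \<alpha> L"
begin

lemma A3_lattice_eq: "L = range (A3_vec \<alpha>)"
proof -
  have I: "{Suc 0..3} = {Suc 0, 2, 3}" by auto
  have "L = {of_int (b 1) *\<^sub>R \<alpha> 1 + of_int (b 2) *\<^sub>R \<alpha> 2 + of_int (b 3) *\<^sub>R \<alpha> 3 | b :: nat \<Rightarrow> int. True}"
    unfolding root_lattice_eq[OF A3] by (simp add: I add.assoc)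
  also have "\<dots> = range (A3_vec \<alpha>)"
  proof (intro equalityI subsetI)
    fix x assume "x \<in> range (A3_vec \<alpha>)"
    then obtain p q r where "x = A3_vec \<alpha> (p, q, r)" by auto
    then show "x \<in> {of_int (b 1) *\<^sub>R \<alpha> 1 + of_int (b 2) *\<^sub>R \<alpha> 2 + of_int (b 3) *\<^sub>R \<alpha> 3 | b :: nat \<Rightarrow> int. True}"
      by (auto simp: A3_vec_def intro!: exI[of _ "\<lambda>i. if i = 1 then p else if i = 2 then q else r"])
  next
    fix x assume "x \<in> {of_int (b 1) *\<^sub>R \<alpha> 1 + of_int (b 2) *\<^sub>R \<alpha> 2 + of_int (b 3) *\<^sub>R \<alpha> 3 | b :: nat \<Rightarrow> int. True}"
    then obtain b :: "nat \<Rightarrow> int" where "x = A3_vec \<alpha> (b 1, b 2, b 3)" by (auto simp: A3_vec_def)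
    then show "x \<in> range (A3_vec \<alpha>)" by blast
  qed
  finally show ?thesis .
qed

lemma A3_gram:
  "\<alpha> 1 \<bullet> \<alpha> 1 = 2" "\<alpha> 2 \<bullet> \<alpha> 2 = 2" "\<alpha> 3 \<bullet> \<alpha> 3 = 2"
  "\<alpha> 1 \<bullet> \<alpha> 2 = -1" "\<alpha> 2 \<bullet> \<alpha> 1 = -1" "\<alpha> 2 \<bullet> \<alpha> 3 = -1" "\<alpha> 3 \<bullet> \<alpha> 2 = -1"
  "\<alpha> 1 \<bullet> \<alpha> 3 = 0" "\<alpha> 3 \<bullet> \<alpha> 1 = 0"
  using A3 by (simp_all add: root_lattice_def cartan_A_def)

lemma A3_inner:
  "A3_vec \<alpha> (p, q, r) \<bullet> A3_vec \<alpha> (p', q', r') =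
    of_int (2 * p * p' + 2 * q * q' + 2 * r * r' - p * q' - q * p' - q * r' - r * q')"
  by (simp add: A3_vec_def inner_add_left inner_add_right A3_gram del: One_nat_def)
     (simp add: algebra_simps)

lemma A3_norm:
  "A3_vec \<alpha> (p, q, r) \<bullet> A3_vec \<alpha> (p, q, r) = of_int (p\<^sup>2 + (q - p)\<^sup>2 + (r - q)\<^sup>2 + r\<^sup>2)"
  unfolding A3_inner of_int_eq_iff by (simp add: power2_eq_square algebra_simps)

lemma A3_norm_even: "x \<in> L \<Longrightarrow> \<exists>k::int. x \<bullet> x = 2 * of_int k"
proof -
  assume "x \<in> L"
  then obtain p q r where x: "x = A3_vec \<alpha> (p, q, r)" by (auto simp: A3_lattice_eq)
  have "x \<bullet> x = 2 * of_int (p * p + q * q + r * r - p * q - q * r)"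
    unfolding x A3_inner by (simp add: algebra_simps)
  then show ?thesis by blast
qed

text \<open>Two triples with the same image differ by a triple of norm 0, and a vanishing sum of
  squares vanishes termwise.\<close>

lemma A3_vec_inj: "inj (A3_vec \<alpha>)"
proof (rule injI)
  fix x y :: "int \<times> int \<times> int"
  assume eq: "A3_vec \<alpha> x = A3_vec \<alpha> y"
  obtain p q r p' q' r' where xy: "x = (p, q, r)" "y = (p', q', r')" by (metis prod_cases3)
  define u v w where "u = p - p'" and "v = q - q'" and "w = r - r'"
  have "A3_vec \<alpha> (u, v, w) = A3_vec \<alpha> x - A3_vec \<alpha> y"
    by (simp add: A3_vec_def xy u_def v_def w_def algebra_simps)
  then have "real_of_int (u\<^sup>2 + (v - u)\<^sup>2 + (w - v)\<^sup>2 + w\<^sup>2) = of_int 0"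
    using A3_norm[of u v w] eq by simp
  then have "u\<^sup>2 + (v - u)\<^sup>2 + (w - v)\<^sup>2 + w\<^sup>2 = 0" by (simp only: of_int_eq_iff)
  moreover have "0 \<le> u\<^sup>2" "0 \<le> (v - u)\<^sup>2" "0 \<le> (w - v)\<^sup>2" "0 \<le> w\<^sup>2" by simp_all
  ultimately have "u\<^sup>2 = 0" "(v - u)\<^sup>2 = 0" "w\<^sup>2 = 0" by linarith+
  then show "x = y" by (simp add: xy u_def v_def w_def)
qed

lemma A3_roots_eq:
  "lattice_roots L = A3_vec \<alpha> ` {(1,0,0), (0,1,0), (0,0,1), (1,1,0), (0,1,1), (1,1,1),
    (-1,0,0), (0,-1,0), (0,0,-1), (-1,-1,0), (0,-1,-1), (-1,-1,-1)}" (is "_ = A3_vec \<alpha> ` ?R")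
proof
  show "lattice_roots L \<subseteq> A3_vec \<alpha> ` ?R"
  proof
    fix \<beta> assume "\<beta> \<in> lattice_roots L"
    then obtain p q r where \<beta>: "\<beta> = A3_vec \<alpha> (p, q, r)" "\<beta> \<bullet> \<beta> = 2"
      by (auto simp: lattice_roots_def A3_lattice_eq)
    then have "real_of_int (p\<^sup>2 + (q - p)\<^sup>2 + (r - q)\<^sup>2 + r\<^sup>2) = of_int 2"
      using A3_norm[of p q r] by simp
    then have "p\<^sup>2 + (q - p)\<^sup>2 + (r - q)\<^sup>2 + r\<^sup>2 = 2" by (simp only: of_int_eq_iff)
    from A3_norm_2_cases[OF this] show "\<beta> \<in> A3_vec \<alpha> ` ?R" unfolding \<beta>(1) by (rule imageI)
  qed
  show "A3_vec \<alpha> ` ?R \<subseteq> lattice_roots L"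
    by (auto simp: lattice_roots_def A3_lattice_eq A3_norm)
qed

lemma A3_extra_norm: "\<beta> \<in> A3_extra_screeners \<alpha> \<Longrightarrow> \<beta> \<bullet> \<beta> = 4"
  unfolding A3_extra_screeners_eq by (auto simp: A3_norm)

text \<open>At norm 4, lying in \<open>2 L\<close> would require a vector of norm 1 in an even
  lattice, and the screener condition asks for even inner products with \<open>L\<close>.\<close>

lemma A3_extra_subset_screeners: "A3_extra_screeners \<alpha> \<subseteq> screeners L"
proof
  fix \<beta> assume \<beta>: "\<beta> \<in> A3_extra_screeners \<alpha>"
  have norm: "\<beta> \<bullet> \<beta> = 4" by (rule A3_extra_norm[OF \<beta>])
  have "\<beta> \<in> L" using \<beta> unfolding A3_extra_screeners_eq A3_lattice_eq by blast
  moreover have "\<exists>k::int. \<beta> \<bullet> \<beta> = 2 * of_int k" using norm by (intro exI[of _ 2]) simp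
  moreover have "\<beta> \<notin> (*\<^sub>R) 2 ` L"
  proof
    assume "\<beta> \<in> (*\<^sub>R) 2 ` L"
    then obtain x where x: "x \<in> L" "\<beta> = 2 *\<^sub>R x" by blast
    obtain k :: int where "x \<bullet> x = 2 * of_int k" using A3_norm_even[OF x(1)] by blast
    then have "real_of_int (2 * k) = 1" using norm x(2) by simp
    then have "2 * k = 1" by linarith
    then show False by presburger
  qed
  moreover have "2 * (x \<bullet> \<beta>) / (\<beta> \<bullet> \<beta>) \<in> \<int>" if "x \<in> L" for x
  proof -
    obtain p q r where x: "x = A3_vec \<alpha> (p, q, r)" using \<open>x \<in> L\<close> by (auto simp: A3_lattice_eq)
    \<comment> \<open>One value for each of the six vectors, in the order of their list of
      triples.\<close>
    have "x \<bullet> \<beta> / 2 \<in> {of_int (p - q + r), of_int (- p + q - r), of_int (p - r),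
        of_int (r - p), of_int q, of_int (- q)}"
      using \<beta> unfolding A3_extra_screeners_eq x by (auto simp: A3_inner)
    then have "x \<bullet> \<beta> / 2 \<in> \<int>" by (auto simp del: of_int_add of_int_diff of_int_minus)
    then show ?thesis by (simp add: norm)
  qed
  ultimately show "\<beta> \<in> screeners L" by (simp add: screeners_iff)
qed

text \<open>The exceptional case \<open>M = 2\<close> of \<open>screener_norm_A\<close> means norm
  4, and all six vectors of norm 4 are screeners.\<close>

lemma A3_screeners_eq: "screeners L = lattice_roots L \<union> A3_extra_screeners \<alpha>"
proof
  show "screeners L \<subseteq> lattice_roots L \<union> A3_extra_screeners \<alpha>"
  proof
    fix \<beta> assume \<beta>: "\<beta> \<in> screeners L"
    then have "\<beta> \<in> L" by (simp add: screeners_iff)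
    obtain b M where M: "\<beta> = (\<Sum>i=1..3. of_int (b i) *\<^sub>R \<alpha> i)" "\<beta> \<bullet> \<beta> = 2 * of_int M" "0 < M"
      "(\<Sum>i=1..3. b i * (\<Sum>j=1..3. cartan_A i j * b j)) = 2 * M"
      "\<forall>i\<in>{1..3}. M dvd (\<Sum>j=1..3. cartan_A i j * b j)"
      by (rule screenerE[OF A3 \<beta>])
    have "M = 1 \<or> M = 2" using screener_norm_A[of 3 M b] M by auto
    then show "\<beta> \<in> lattice_roots L \<union> A3_extra_screeners \<alpha>"
    proof
      assume "M = 1"
      then show ?thesis using M(2) \<open>\<beta> \<in> L\<close> by (simp add: lattice_roots_def)
    next
      assume "M = 2"
      obtain p q r where pqr: "\<beta> = A3_vec \<alpha> (p, q, r)" using \<open>\<beta> \<in> L\<close> by (auto simp: A3_lattice_eq)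
      then have "real_of_int (p\<^sup>2 + (q - p)\<^sup>2 + (r - q)\<^sup>2 + r\<^sup>2) = of_int 4"
        using A3_norm[of p q r] M(2) \<open>M = 2\<close> by simp
      then have "p\<^sup>2 + (q - p)\<^sup>2 + (r - q)\<^sup>2 + r\<^sup>2 = 4" by (simp only: of_int_eq_iff)
      from A3_norm_4_cases[OF this] have "\<beta> \<in> A3_extra_screeners \<alpha>"
        unfolding A3_extra_screeners_eq pqr by (rule imageI)
      then show ?thesis ..
    qed
  qed
qed (use lattice_roots_subset_screeners[OF A3] A3_extra_subset_screeners in blast)

lemma A3_card_extra: "card (A3_extra_screeners \<alpha>) = 6"
  unfolding A3_extra_screeners_eq by (subst card_image[OF inj_on_subset[OF A3_vec_inj]]) auto

section \<open>The root system of type \<open>C_3\<close>\<close>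

lemma A3_root_system: "root_system (span L) (screeners L)"
  unfolding root_system_def
proof (intro conjI ballI allI impI)
  show "finite (screeners L)"
    unfolding A3_screeners_eq A3_roots_eq A3_extra_screeners_eq by blast
  have "0 \<in> L" using root_lattice_diff_scale[OF A3, of "\<alpha> 1" "\<alpha> 1" 1] root_lattice_gen[OF A3, of 1] by simp
  then show "0 \<notin> screeners L" by (auto simp: screeners_iff image_iff)
  have "\<alpha> i \<in> screeners L" if "i \<in> {1..3}" for i
    using root_lattice_gen[OF A3 that] that A3 lattice_roots_subset_screeners[OF A3]
    by (auto simp: lattice_roots_def root_lattice_def cartan_A_def)
  then have "A3_vec \<alpha> x \<in> span (screeners L)" for x
    by (cases x) (simp add: A3_vec_def span_add span_scale span_base)
  then have "L \<subseteq> span (screeners L)" by (auto simp: A3_lattice_eq)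
  moreover have "screeners L \<subseteq> span L" by (auto simp: screeners_iff intro: span_base)
  ultimately show "span (screeners L) = span L"
    by (simp add: span_eq)
  fix \<beta> assume \<beta>: "\<beta> \<in> screeners L"
  show "c = 1 \<or> c = -1" if "c *\<^sub>R \<beta> \<in> screeners L" for c
    using scaleR_eq_screenerD[OF \<beta> that \<open>0 \<in> L\<close>] root_lattice_diff_scale[OF A3 \<open>0 \<in> L\<close>, of _ 1] by simp
  fix \<gamma> assume \<gamma>: "\<gamma> \<in> screeners L"
  show "\<gamma> - (2 * (\<gamma> \<bullet> \<beta>) / (\<beta> \<bullet> \<beta>)) *\<^sub>R \<beta> \<in> screeners L"
    by (rule screeners_reflection[OF \<beta> \<gamma> root_lattice_diff_scale[OF A3]])
  show "2 * (\<gamma> \<bullet> \<beta>) / (\<beta> \<bullet> \<beta>) \<in> \<int>"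
    using \<beta> \<gamma> by (simp add: screeners_iff)
qed

text \<open>Two short roots of norm 2 followed by the long one of norm 4, which is orthogonal to
  \<open>\<alpha> 2\<close> and has inner product -2 with \<open>\<alpha> 1\<close>. In the
  coordinates of \<open>A_3 = D_3\<close> the added screeners are the vectors \<open>2 e_i\<close>
  and their negatives, the long roots of \<open>C_3\<close>.\<close>

definition C3_base :: "nat \<Rightarrow> 'a" where
  "C3_base i = (if i = 1 then \<alpha> 2 else if i = 2 then \<alpha> 1 else \<alpha> 3 - \<alpha> 1)"

lemma C3_base_cartan:
  assumes "i \<in> {1..3}" "j \<in> {1..3}"
  shows "2 * (C3_base i \<bullet> C3_base j) / (C3_base j \<bullet> C3_base j) = of_int (cartan_C 3 i j)"
proof -
  have "i = 1 \<or> i = 2 \<or> i = 3" "j = 1 \<or> j = 2 \<or> j = 3" using assms by auto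
  then show ?thesis
    by (elim disjE; simp add: C3_base_def cartan_C_def cartan_A_def inner_diff_left inner_diff_right
        A3_gram[unfolded One_nat_def])
qed

lemma C3_base_image: "C3_base ` {1..3} = {\<alpha> 2, \<alpha> 1, \<alpha> 3 - \<alpha> 1}"
proof -
  have "{1..3::nat} = {1, 2, 3}" by auto
  then show ?thesis by (simp add: C3_base_def insert_commute)
qed

lemma C3_base_distinct: "\<alpha> 2 \<noteq> \<alpha> 1" "\<alpha> 3 - \<alpha> 1 \<noteq> \<alpha> 1" "\<alpha> 3 - \<alpha> 1 \<noteq> \<alpha> 2"
proof -
  have "(\<alpha> 3 - \<alpha> 1) \<bullet> (\<alpha> 3 - \<alpha> 1) = 4"
    by (simp add: inner_diff_left inner_diff_right A3_gram del: One_nat_def)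
  then show "\<alpha> 3 - \<alpha> 1 \<noteq> \<alpha> 1" "\<alpha> 3 - \<alpha> 1 \<noteq> \<alpha> 2" using A3_gram by auto
  show "\<alpha> 2 \<noteq> \<alpha> 1" using A3_gram by auto
qed

lemma C3_base_independent: "independent (C3_base ` {1..3})"
proof
  assume "dependent (C3_base ` {1..3})"
  then obtain u where u: "\<exists>v\<in>{\<alpha> 2, \<alpha> 1, \<alpha> 3 - \<alpha> 1}. u v \<noteq> 0"
    and "(\<Sum>v\<in>{\<alpha> 2, \<alpha> 1, \<alpha> 3 - \<alpha> 1}. u v *\<^sub>R v) = 0"
    unfolding C3_base_image by (subst (asm) dependent_finite) auto
  then have sum: "u (\<alpha> 2) *\<^sub>R \<alpha> 2 + u (\<alpha> 1) *\<^sub>R \<alpha> 1 + u (\<alpha> 3 - \<alpha> 1) *\<^sub>R (\<alpha> 3 - \<alpha> 1) = 0"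
    using C3_base_distinct by (simp add: add.assoc)
  \<comment> \<open>Pairing the relation with the three simple roots of \<open>A_3\<close> gives a
    nonsingular linear system for the coefficients.\<close>
  have "\<alpha> i \<bullet> (u (\<alpha> 2) *\<^sub>R \<alpha> 2 + u (\<alpha> 1) *\<^sub>R \<alpha> 1 + u (\<alpha> 3 - \<alpha> 1) *\<^sub>R (\<alpha> 3 - \<alpha> 1)) = 0" for i
    unfolding sum by simp
  from this[of 1] this[of 2] this[of 3]
  have "2 * u (\<alpha> 1) - u (\<alpha> 2) - 2 * u (\<alpha> 3 - \<alpha> 1) = 0"
    "2 * u (\<alpha> 2) - u (\<alpha> 1) = 0" "2 * u (\<alpha> 3 - \<alpha> 1) - u (\<alpha> 2) = 0"
    by (simp_all add: inner_add_right inner_diff_right A3_gram del: One_nat_def)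
  then have "u (\<alpha> 1) = 0" "u (\<alpha> 2) = 0" "u (\<alpha> 3 - \<alpha> 1) = 0" by linarith+
  with u show False by auto
qed

lemma A3_vec_C3_base:
  "A3_vec \<alpha> (p, q, r) =
    of_int q *\<^sub>R C3_base 1 + of_int (p + r) *\<^sub>R C3_base 2 + of_int r *\<^sub>R C3_base 3"
  by (simp add: A3_vec_def C3_base_def algebra_simps)

lemma C3_base_span: "span (C3_base ` {1..3}) = span L"
proof -
  have "A3_vec \<alpha> x \<in> span (C3_base ` {1..3})" for x
    by (cases x) (simp add: A3_vec_C3_base span_add span_scale span_base del: of_int_add)
  then have "L \<subseteq> span (C3_base ` {1..3})" by (auto simp: A3_lattice_eq)
  moreover have "C3_base ` {1..3} \<subseteq> span L"
    unfolding C3_base_image using root_lattice_gen[OF A3] by (simp add: span_diff span_base)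
  ultimately show ?thesis by (simp add: span_eq)
qed

lemma A3_screener_C3_base_coeffs:
  assumes "\<beta> \<in> screeners L"
  shows "\<exists>c :: nat \<Rightarrow> nat. \<beta> = (\<Sum>i=1..3. of_nat (c i) *\<^sub>R C3_base i) \<or>
    \<beta> = - (\<Sum>i=1..3. of_nat (c i) *\<^sub>R C3_base i)"
proof -
  \<comment> \<open>\<open>q\<close>, \<open>p + r\<close> and \<open>r\<close> are the coefficients
    in the new base; their common sign is checked on the 18 listed triples.\<close>
  obtain p q r where \<beta>: "\<beta> = A3_vec \<alpha> (p, q, r)"
    and sign: "(0 \<le> q \<and> 0 \<le> p + r \<and> 0 \<le> r) \<or> (q \<le> 0 \<and> p + r \<le> 0 \<and> r \<le> 0)"
    using assms unfolding A3_screeners_eq A3_roots_eq A3_extra_screeners_eq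
    by fastforce
  \<comment> \<open>Absolute values serve both sign cases with one \<open>c\<close>.\<close>
  define c where "c i = nat \<bar>if i = 1 then q else if i = 2 then p + r else r\<bar>" for i :: nat
  have I: "{1..3::nat} = {1, 2, 3}" by auto
  have sum: "(\<Sum>i=1..3. of_nat (c i) *\<^sub>R C3_base i) =
      of_int \<bar>q\<bar> *\<^sub>R C3_base 1 + of_int \<bar>p + r\<bar> *\<^sub>R C3_base 2 + of_int \<bar>r\<bar> *\<^sub>R C3_base 3"
    unfolding I by (simp add: c_def add.assoc)
  from sign show ?thesis
  proof
    assume "0 \<le> q \<and> 0 \<le> p + r \<and> 0 \<le> r"
    then have "\<beta> = (\<Sum>i=1..3. of_nat (c i) *\<^sub>R C3_base i)"
      unfolding \<beta> A3_vec_C3_base sum by simp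
    then show ?thesis by blast
  next
    assume "q \<le> 0 \<and> p + r \<le> 0 \<and> r \<le> 0"
    then have "\<beta> = - (\<Sum>i=1..3. of_nat (c i) *\<^sub>R C3_base i)"
      unfolding \<beta> A3_vec_C3_base sum by (simp add: algebra_simps)
    then show ?thesis by blast
  qed
qed

lemma A3_screeners_type_C3: "root_system_of_type (cartan_C 3) 3 (span L) (screeners L)"
proof -
  have "C3_base i = A3_vec \<alpha> (if i = 1 then (0,1,0) else if i = 2 then (1,0,0) else (-1,0,1))" for i
    by (simp add: C3_base_def A3_vec_def)
  then have "C3_base ` {1..3} \<subseteq> screeners L"
    unfolding A3_screeners_eq A3_roots_eq A3_extra_screeners_eq by auto
  moreover have "inj_on C3_base {1..3}"
    using C3_base_distinct by (auto simp: inj_on_def C3_base_def)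
  ultimately have "root_system_base (span L) (screeners L) 3 C3_base"
    unfolding root_system_base_def
    using C3_base_independent C3_base_span A3_screener_C3_base_coeffs by blast
  then show ?thesis
    unfolding root_system_of_type_def using A3_root_system C3_base_cartan by blast
qed

end

theorem theorem5p14:
  shows
    "(\<forall>n\<in>{6, 7, 8}. \<forall>(\<alpha> :: nat \<Rightarrow> 'a::real_inner) L.
        root_lattice cartan_E n \<alpha> L \<longrightarrow> screeners L = lattice_roots L) \<and>
     (\<forall>n>3. \<forall>(\<alpha> :: nat \<Rightarrow> 'a) L.
        root_lattice cartan_A n \<alpha> L \<longrightarrow> screeners L = lattice_roots L) \<and>
     (\<forall>(\<alpha> :: nat \<Rightarrow> 'a) L. root_lattice cartan_A 3 \<alpha> L \<longrightarrow>
        lattice_roots L \<subseteq> screeners L \<and>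
        screeners L - lattice_roots L = A3_extra_screeners \<alpha> \<and>
        card (A3_extra_screeners \<alpha>) = 6 \<and>
        (\<forall>\<beta>\<in>A3_extra_screeners \<alpha>. \<beta> \<bullet> \<beta> = 4) \<and>
        root_system_of_type (cartan_C 3) 3 (span L) (lattice_roots L \<union> A3_extra_screeners \<alpha>))"
  proof (intro conjI ballI allI impI)
  fix n and \<alpha> :: "nat \<Rightarrow> 'a" and L :: "'a set"
  assume "n \<in> {6, 7, 8::nat}" and E: "root_lattice cartan_E n \<alpha> L"
  then show "screeners L = lattice_roots L"
    using screener_norm_E6 screener_norm_E7 screener_norm_E8
    by (intro screeners_eq_lattice_rootsI[OF E]) blast
next
  fix n and \<alpha> :: "nat \<Rightarrow> 'a" and L :: "'a set"
  assume "3 < n" and A: "root_lattice cartan_A n \<alpha> L"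
  show "screeners L = lattice_roots L"
  proof (rule screeners_eq_lattice_rootsI[OF A])
    fix b M
    assume "0 < M" "(\<Sum>i=1..n. b i * (\<Sum>j=1..n. cartan_A i j * b j)) = 2 * M"
      "\<And>i. i \<in> {1..n} \<Longrightarrow> M dvd (\<Sum>j=1..n. cartan_A i j * b j)"
    then show "M = 1" using screener_norm_A[of n M b] \<open>3 < n\<close> by simp
  qed
next
  fix \<alpha> :: "nat \<Rightarrow> 'a" and L :: "'a set"
  assume A3: "root_lattice cartan_A 3 \<alpha> L"
  show "lattice_roots L \<subseteq> screeners L" by (rule lattice_roots_subset_screeners[OF A3])
  \<comment> \<open>The norms 4 and 2 separate the two sets.\<close>
  have "A3_extra_screeners \<alpha> \<inter> lattice_roots L = {}"
    using A3_extra_norm[OF A3] by (force simp: lattice_roots_def)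
  then show "screeners L - lattice_roots L = A3_extra_screeners \<alpha>"
    unfolding A3_screeners_eq[OF A3] by blast
  show "card (A3_extra_screeners \<alpha>) = 6" by (rule A3_card_extra[OF A3])
  show "\<beta> \<bullet> \<beta> = 4" if "\<beta> \<in> A3_extra_screeners \<alpha>" for \<beta>
    by (rule A3_extra_norm[OF A3 that])
  show "root_system_of_type (cartan_C 3) 3 (span L) (lattice_roots L \<union> A3_extra_screeners \<alpha>)"
    using A3_screeners_type_C3[OF A3] by (simp only: A3_screeners_eq[OF A3])
qed

end
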